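(* Let $(X,X_+)$ be a pre-Riesz space, and let $\operatorname{BandPr}(X)$ denote the set of all band projections on $X$, ordered by $P \le Q$ if and only if $(Q-P)X_+ \subseteq X_+$. Then $\operatorname{BandPr}(X)$ is a Boolean algebra with smallest element $0$ and largest element $I$ (the identity operator). The lattice operations $\land$ (infimum) and $\lor$ (supremum) on this Boolean algebra are given by $$P \land Q = PQ \quad \text{and} \quad P \lor Q = P + Q - PQ$$ for all band projections $P, Q$ on $X$, and the complement is given by $P^c = I - P$ for each band projection $P$ on $X$.
   Context: An ordered vector space $(X,X_+)$ is a real vector space $X$ with a non-empty set $X_+ \subseteq X$ such that $X_+ \cap (-X_+) = \{0\}$ and $\alpha X_+ + \beta X_+ \subseteq X_+$ for all $\alpha,\beta \in [0,\infty)$; one writes $x \le y$ if $y - x \in X_+$. It is a pre-Riesz space if for every non-empty finite set $A \subseteq X$ and every $x \in X$: if every upper bound of $x + A$ is an upper bound of $A$, then $x \in X_+$. Two elements $x,y \in X$ are disjoint, $x \perp y$, if the sets $\{x+y,-x-y\}$ and $\{x-y,y-x\}$ have the same set of upper bounds in $X$. For $S \subseteq X$, $S^\perp := \{x \in X : x \perp s \text{ for all } s \in S\}$ (in a pre-Riesz space this is always a vector subspace). A set $B \subseteq X$ is a band if $B = B^{\perp\perp} := (B^\perp)^\perp$. A band $B$ is a projection band if $X = B \oplus B^\perp$. A linear projection $P: X \to X$ is a band projection if there is a projection band $B$ such that $P$ is the projection onto $B$ along $B^\perp$. A Boolean algebra is a non-empty partially ordered set in which any two elements have an infimum $\land$ and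 a supremum $\lor$, these operations are distributive, there exist a smallest element $0$ and a largest element $1$, and each element $x$ has a complement $x^c$, i.e. $x \land x^c = 0$ and $x \lor x^c = 1$. *)

theory Defs
  imports Complex_Main "HOL-Algebra.Lattice"
begin

section \<open>Pre-Riesz spaces\<close>

definition (in ord) upper_bounds :: "'a set \<Rightarrow> 'a set" where
  "upper_bounds A = {u. \<forall>a\<in>A. a \<le> u}"

text \<open>
  The class \<open>ordered_real_vector\<close> is the library's version of an ordered vector space
  \<open>(X, X\<^sub>+)\<close>: \<open>X\<close> is the whole type, \<open>X\<^sub>+ = {x. 0 \<le> x}\<close>, and \<open>x \<le> y\<close> iff \<open>y - x \<in> X\<^sub>+\<close>.
  Conversely, every \<open>X\<^sub>+\<close> as in the usual cone definition induces such an order.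
\<close>

class pre_riesz_space = ordered_real_vector +
  assumes pre_riesz:
    "\<lbrakk>finite A; A \<noteq> {}; upper_bounds ((+) x ` A) \<subseteq> upper_bounds A\<rbrakk> \<Longrightarrow> 0 \<le> x"

abbreviation positive_cone :: "'a::ordered_real_vector set" where
  "positive_cone \<equiv> {x. 0 \<le> x}"

text \<open>Sanity check that the class axioms give exactly the cone axioms and the cone order.\<close>

lemma positive_cone_Int_uminus:
  "(positive_cone :: 'a::ordered_real_vector set) \<inter> uminus ` positive_cone = {0}"
  by (auto simp: image_iff)

lemma positive_cone_combination:
  fixes x y :: "'a::ordered_real_vector"
  assumes "0 \<le> a" "0 \<le> b" "x \<in> positive_cone" "y \<in> positive_cone"
  shows "a *\<^sub>R x + b *\<^sub>R y \<in> positive_cone"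
  using assms by (simp add: scaleR_nonneg_nonneg)

lemma le_iff_diff_in_positive_cone:
  fixes x y :: "'a::ordered_real_vector"
  shows "x \<le> y \<longleftrightarrow> y - x \<in> positive_cone"
  by simp

section \<open>Disjointness, bands and band projections\<close>

definition disjoint_elems :: "'a::ordered_real_vector \<Rightarrow> 'a \<Rightarrow> bool" where
  "disjoint_elems x y \<longleftrightarrow> upper_bounds {x + y, - x - y} = upper_bounds {x - y, y - x}"

definition disjoint_compl :: "'a::ordered_real_vector set \<Rightarrow> 'a set" where
  "disjoint_compl S = {x. \<forall>s\<in>S. disjoint_elems x s}"

definition band :: "'a::ordered_real_vector set \<Rightarrow> bool" where
  "band B \<longleftrightarrow> B = disjoint_compl (disjoint_compl B)"

definition direct_sum_decomp :: "'a::real_vector set \<Rightarrow> 'a set \<Rightarrow> bool" where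
  "direct_sum_decomp U V \<longleftrightarrow>
     subspace U \<and> subspace V \<and> U \<inter> V = {0} \<and> {u + v | u v. u \<in> U \<and> v \<in> V} = UNIV"

definition projection_band :: "'a::ordered_real_vector set \<Rightarrow> bool" where
  "projection_band B \<longleftrightarrow> band B \<and> direct_sum_decomp B (disjoint_compl B)"

definition linear_projection :: "('a::real_vector \<Rightarrow> 'a) \<Rightarrow> bool" where
  "linear_projection P \<longleftrightarrow> linear P \<and> P \<circ> P = P"

definition band_projection :: "('a::ordered_real_vector \<Rightarrow> 'a) \<Rightarrow> bool" where
  "band_projection P \<longleftrightarrow> linear_projection P \<and>
     (\<exists>B. projection_band B \<and> range P = B \<and> P -` {0} = disjoint_compl B)"

definition BandPr :: "('a::ordered_real_vector \<Rightarrow> 'a) gorder" where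
  "BandPr = \<lparr>carrier = {P. band_projection P}, eq = (=),
     le = (\<lambda>P Q. (\<lambda>x. Q x - P x) ` positive_cone \<subseteq> positive_cone)\<rparr>"

section \<open>Boolean algebras as ordered sets\<close>

definition is_complement :: "('a, 'b) gorder_scheme \<Rightarrow> 'a \<Rightarrow> 'a \<Rightarrow> bool" where
  "is_complement L x y \<longleftrightarrow> y \<in> carrier L \<and>
     x \<sqinter>\<^bsub>L\<^esub> y = \<bottom>\<^bsub>L\<^esub> \<and> x \<squnion>\<^bsub>L\<^esub> y = \<top>\<^bsub>L\<^esub>"

locale boolean_lattice = bounded_lattice L for L (structure) +
  assumes nonempty: "carrier L \<noteq> {}"
    and meet_join_distrib: "\<lbrakk>x \<in> carrier L; y \<in> carrier L; z \<in> carrier L\<rbrakk> \<Longrightarrow>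
      x \<sqinter> (y \<squnion> z) = (x \<sqinter> y) \<squnion> (x \<sqinter> z)"
    and join_meet_distrib: "\<lbrakk>x \<in> carrier L; y \<in> carrier L; z \<in> carrier L\<rbrakk> \<Longrightarrow>
      x \<squnion> (y \<sqinter> z) = (x \<squnion> y) \<sqinter> (x \<squnion> z)"
    and complement_exists: "x \<in> carrier L \<Longrightarrow> \<exists>y. is_complement L x y"

end

(*
  A linear projection P is a band projection iff 0 <= Px <= x for all x >= 0.
  If x = u + v >= 0 with u, v disjoint, then x is an upper bound of {u + v, -u - v}, hence of
  {u - v, v - u}, which says 2v >= 0 and 2u >= 0.  Conversely, if P and I - P are positive, an
  upper bound z of {u + v, -u - v} splits as Pz + (I - P)z, so range P and ker P are disjoint,
  and directedness of X shows that they are each other's disjoint complements.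
  If P and Q both have this property, then 0 <= QPx <= Px for x >= 0 gives (I - P)QP = 0; the
  same for I - P gives PQ = PQP, so P and Q commute, and the Boolean identities are those of
  commuting idempotents.
*)
theory Submission
  imports Defs
begin

section \<open>Directedness and elementary facts on disjointness\<close>

text \<open>Without a common upper bound of x and y, the pre-Riesz axiom for the set consisting
  of x and y would hold vacuously, making every element positive.\<close>

lemma pre_riesz_directed:
  fixes x y :: "'a::pre_riesz_space"
  obtains z where "x \<le> z" "y \<le> z"
proof (rule ccontr)
  assume "\<not> thesis"
  then have none: "\<not> (x \<le> z \<and> y \<le> z)" for z
    using that by blast
  have "upper_bounds ((+) w ` {x, y}) = {}" for w
    using none[of "u - w" for u] by (auto simp: upper_bounds_def le_diff_eq add.commute)
  then have "0 \<le> w" for w :: 'a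
    using pre_riesz[of "{x, y}" w] by simp
  from this[of "y - x"] none[of y] show False
    by simp
qed

text \<open>By directedness the cone generates the space: any \<open>x\<close> is the difference
  \<open>z - (z - x)\<close> of two positive elements, where \<open>z\<close> is a common upper
  bound of \<open>x\<close> and \<open>0\<close>.\<close>

lemma linear_eq_onI_positive:
  fixes f g :: "'a::pre_riesz_space \<Rightarrow> 'b::real_vector"
  assumes "linear f" "linear g" and eq: "\<And>x. 0 \<le> x \<Longrightarrow> f x = g x"
  shows "f = g"
proof
  fix x :: 'a
  obtain z where "x \<le> z" "0 \<le> z"
    by (rule pre_riesz_directed)
  then have "f z - f (z - x) = g z - g (z - x)"
    by (simp add: eq)
  then show "f x = g x"
    by (simp add: linear_diff assms(1,2))
qed

lemma scaleR2_nonneg_iff: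
  fixes x :: "'a::ordered_real_vector"
  shows "0 \<le> x + x \<longleftrightarrow> 0 \<le> x"
  using zero_le_scaleR_iff[of 2 x] by (simp add: scaleR_2)

lemma disjoint_elems_sym: "disjoint_elems x y \<longleftrightarrow> disjoint_elems y x"
proof -
  have "{x + y, - x - y} = {y + x, - y - x}" "{x - y, y - x} = {y - x, x - y}"
    by (auto simp: algebra_simps)
  then show ?thesis
    by (simp add: disjoint_elems_def)
qed

lemma disjoint_elems_nonneg:
  assumes "disjoint_elems u v" "0 \<le> u + v"
  shows "0 \<le> u" "0 \<le> v"
proof -
  have "- u - v \<le> u + v"
    using assms(2) by (metis add.commute minus_add neg_le_0_iff_le order_trans uminus_add_conv_diff)
  then have "u + v \<in> upper_bounds {u + v, - u - v}"
    by (simp add: upper_bounds_def)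
  then have "u + v \<in> upper_bounds {u - v, v - u}"
    using assms(1) by (simp only: disjoint_elems_def)
  then have "u - v \<le> u + v" "v - u \<le> u + v"
    by (simp_all add: upper_bounds_def)
  \<comment> \<open>Written as \<open>a <= a + b\<close>, the two bounds cancel to positivity of the
    doubled elements, which can then be halved.\<close>
  then have "u - v \<le> u - v + (v + v)" "v - u \<le> v - u + (u + u)"
    by (simp_all add: algebra_simps)
  then have "0 \<le> v + v" "0 \<le> u + u"
    by (simp_all only: le_add_same_cancel1)
  then show "0 \<le> u" "0 \<le> v"
    by (simp_all add: scaleR2_nonneg_iff)
qed

section \<open>Order projections and disjointness\<close>

text \<open>A description of band projections that mentions neither bands nor disjointness;
  \<open>band_projection_iff_order_projection\<close> identifies the two notions on pre-Riesz
  spaces.\<close>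

definition order_projection :: "('a::ordered_real_vector \<Rightarrow> 'a) \<Rightarrow> bool" where
  "order_projection P \<longleftrightarrow> linear P \<and> (\<forall>x. P (P x) = P x) \<and> (\<forall>x\<ge>0. 0 \<le> P x \<and> P x \<le> x)"

lemma order_projectionD:
  assumes "order_projection P"
  shows "linear P" "P (P x) = P x" "0 \<le> x \<Longrightarrow> 0 \<le> P x" "0 \<le> x \<Longrightarrow> P x \<le> x"
  using assms by (auto simp: order_projection_def)

text \<open>The bounds \<open>0 <= P x <= x\<close> are symmetric in \<open>P\<close> and
  \<open>I - P\<close>. Results on the range of \<open>P\<close> thereby transfer to its
  kernel.\<close>

lemma order_projection_compl:
  assumes "order_projection P"
  shows "order_projection (\<lambda>x. x - P x)"
  using order_projectionD[OF assms]
  by (auto simp: order_projection_def linear_diff intro: linear_compose_sub linear_ident)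

lemma order_projection_mono:
  assumes "order_projection P" "x \<le> y"
  shows "P x \<le> P y"
  using order_projectionD(3)[OF assms(1), of "y - x"] assms(2)
  by (simp add: linear_diff order_projectionD(1)[OF assms(1)])

text \<open>The monotone maps \<open>P\<close> and \<open>I - P\<close> split an upper bound
  \<open>z\<close> into \<open>P z\<close>, which dominates \<open>u\<close> and \<open>- u\<close>,
  and \<open>z - P z\<close>, which dominates \<open>v\<close> and \<open>- v\<close>. These bounds
  can be added with any choice of signs.\<close>

lemma order_projection_disjoint:
  assumes P: "order_projection P" and u: "P u = u" and v: "P v = 0"
  shows "disjoint_elems u v"
proof -
  have *: "upper_bounds {u + v, - u - v} \<subseteq> upper_bounds {u - v, v - u}"
    if u: "P u = u" and v: "P v = 0" for u v
  proof
    fix z assume "z \<in> upper_bounds {u + v, - u - v}"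
    then have z: "u + v \<le> z" "- u - v \<le> z"
      by (auto simp: upper_bounds_def)
    let ?R = "\<lambda>x. x - P x"
    note lin = linear_add[OF order_projectionD(1)[OF P]] linear_diff[OF order_projectionD(1)[OF P]]
      linear_neg[OF order_projectionD(1)[OF P]]
    have p: "u \<le> P z" "- u \<le> P z"
      using z[THEN order_projection_mono[OF P]] by (simp_all add: lin u v)
    have q: "v \<le> ?R z" "- v \<le> ?R z"
      using z[THEN order_projection_mono[OF order_projection_compl[OF P]]]
      by (simp_all add: lin u v)
    show "z \<in> upper_bounds {u - v, v - u}"
      using add_mono[OF p(1) q(2)] add_mono[OF p(2) q(1)] by (simp add: upper_bounds_def)
  qed
  \<comment> \<open>The reverse inclusion is \<open>*\<close> with \<open>- v\<close> in place of
    \<open>v\<close>.\<close>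
  have "P (- v) = 0"
    using linear_neg[OF order_projectionD(1)[OF P], of v] v by simp
  from *[OF u v] *[OF u this] show ?thesis
    by (auto simp: disjoint_elems_def minus_diff_commute[of v u])
qed

lemma order_projection_disjoint_image:
  fixes P :: "'a::pre_riesz_space \<Rightarrow> 'a"
  assumes P: "order_projection P" and dis: "disjoint_elems x (P x)"
  shows "P x = 0"
proof -
  define u v where "u = P x" and "v = x - P x"
  note lin = linear_add[OF order_projectionD(1)[OF P]] linear_diff[OF order_projectionD(1)[OF P]]
    linear_neg[OF order_projectionD(1)[OF P]]
  have u: "P u = u" and v: "P v = 0"
    by (simp_all add: u_def v_def lin order_projectionD(2)[OF P])
  obtain z where z: "v \<le> z" "- v \<le> z"
    by (rule pre_riesz_directed)
  \<comment> \<open>Applying \<open>I - P\<close> to \<open>z\<close> keeps it above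
    \<open>v\<close> and \<open>- v\<close>, since \<open>v\<close> lies in the kernel of
    \<open>P\<close>, and gives \<open>P ?w = 0\<close>. Disjointness puts \<open>?w\<close> above
    \<open>x + P x\<close> and its negative; applying \<open>P\<close> then bounds
    \<open>2 u\<close> and \<open>- 2 u\<close> by \<open>0\<close>.\<close>
  let ?w = "z - P z"
  have "v \<le> ?w" "- v \<le> ?w"
    using z[THEN order_projection_mono[OF order_projection_compl[OF P]]]
    by (simp_all add: lin v)
  then have "?w \<in> upper_bounds {x - P x, P x - x}"
    by (simp add: upper_bounds_def v_def)
  then have "x + P x \<le> ?w" "- x - P x \<le> ?w"
    using dis by (auto simp: disjoint_elems_def upper_bounds_def)
  from this[THEN order_projection_mono[OF P]]
  have "u + u \<le> 0" "- u - u \<le> 0"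
    by (simp_all add: lin order_projectionD(2)[OF P] u_def)
  then have "0 \<le> - u + - u" "0 \<le> u + u"
    by (metis minus_add_distrib neg_0_le_iff_le,
        metis minus_add_distrib diff_conv_add_uminus neg_le_0_iff_le)
  then have "0 \<le> - u" "0 \<le> u"
    by (simp_all only: scaleR2_nonneg_iff)
  then show ?thesis
    by (simp add: u_def)
qed

text \<open>An element disjoint from the whole range is in particular disjoint from its own image,
  which forces that image to be zero. The other inclusion is disjointness of range and
  kernel.\<close>

lemma order_projection_disjoint_compl_range:
  fixes P :: "'a::pre_riesz_space \<Rightarrow> 'a"
  assumes P: "order_projection P"
  shows "disjoint_compl (range P) = P -` {0}"
proof
  show "disjoint_compl (range P) \<subseteq> P -` {0}"
    using order_projection_disjoint_image[OF P] by (auto simp: disjoint_compl_def)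
  have "disjoint_elems x (P y)" if "P x = 0" for x y
    using order_projection_disjoint[OF P order_projectionD(2)[OF P] that]
    by (simp add: disjoint_elems_sym)
  then show "P -` {0} \<subseteq> disjoint_compl (range P)"
    by (auto simp: disjoint_compl_def)
qed

lemma order_projection_compl_range_kernel:
  assumes P: "order_projection P"
  shows "range (\<lambda>x. x - P x) = P -` {0}" "(\<lambda>x. x - P x) -` {0} = range P"
proof -
  have "x \<in> range (\<lambda>x. x - P x)" if "P x = 0" for x
    using that by (intro image_eqI[of _ _ x]) auto
  then show "range (\<lambda>x. x - P x) = P -` {0}"
    by (auto simp: linear_diff[OF order_projectionD(1)[OF P]] order_projectionD(2)[OF P])
  show "(\<lambda>x. x - P x) -` {0} = range P"
    using order_projectionD(2)[OF P] by (auto intro: range_eqI)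
qed

text \<open>Computing the disjoint complement once for \<open>P\<close> and once for
  \<open>I - P\<close> leads from the range to the kernel and back, so the range is its own double
  complement.\<close>

lemma order_projection_projection_band:
  fixes P :: "'a::pre_riesz_space \<Rightarrow> 'a"
  assumes P: "order_projection P"
  shows "projection_band (range P)"
proof -
  note lin = order_projectionD(1)[OF P]
  have ker: "disjoint_compl (range P) = P -` {0}"
    by (rule order_projection_disjoint_compl_range[OF P])
  have "disjoint_compl (P -` {0}) = range P"
    using order_projection_disjoint_compl_range[OF order_projection_compl[OF P]]
    by (simp add: order_projection_compl_range_kernel[OF P])
  then have "band (range P)"
    by (simp add: band_def ker)
  moreover have "direct_sum_decomp (range P) (P -` {0})"
    unfolding direct_sum_decomp_def
  proof (intro conjI)
    show "subspace (range P)"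
      by (rule linear_subspace_image[OF lin subspace_UNIV])
    show "subspace (P -` {0})"
      by (rule linear_subspace_vimage[OF lin]) (simp add: subspace_def)
    have "0 \<in> range P"
      using linear_0[OF lin] by (metis rangeI)
    then show "range P \<inter> P -` {0} = {0}"
      using order_projectionD(2)[OF P] linear_0[OF lin] by auto
    have "\<exists>u v. x = u + v \<and> u \<in> range P \<and> v \<in> P -` {0}" for x
      by (intro exI[of _ "P x"] exI[of _ "x - P x"])
        (simp add: linear_diff[OF lin] order_projectionD(2)[OF P])
    then show "{u + v | u v. u \<in> range P \<and> v \<in> P -` {0}} = UNIV"
      by blast
  qed
  ultimately show ?thesis
    by (simp add: projection_band_def ker)
qed

section \<open>Characterization of band projections\<close>

lemma band_projection_iff_order_projection:
  fixes P :: "'a::pre_riesz_space \<Rightarrow> 'a"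
  shows "band_projection P \<longleftrightarrow> order_projection P"
proof
  assume "order_projection P"
  then show "band_projection P"
    using order_projection_projection_band order_projection_disjoint_compl_range
    by (auto simp: band_projection_def linear_projection_def fun_eq_iff order_projectionD)
next
  assume "band_projection P"
  then have lin: "linear P" and idem: "\<And>x. P (P x) = P x"
    and ker: "P -` {0} = disjoint_compl (range P)"
    by (auto simp: band_projection_def linear_projection_def fun_eq_iff)
  have "0 \<le> P x \<and> P x \<le> x" if "0 \<le> x" for x
  proof -
    \<comment> \<open>The summands \<open>x - P x\<close> and \<open>P x\<close> of \<open>x\<close>
      are disjoint, so both are positive if \<open>x\<close> is.\<close>
    have "x - P x \<in> P -` {0}"
      by (simp add: linear_diff[OF lin] idem)
    then have "disjoint_elems (x - P x) (P x)"
      unfolding ker by (simp add: disjoint_compl_def)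
    from disjoint_elems_nonneg[OF this] that show ?thesis
      by simp
  qed
  then show "order_projection P"
    by (simp add: order_projection_def lin idem)
qed

section \<open>Commutation, products and joins\<close>

text \<open>Since \<open>I - P\<close> is monotone and kills the range of \<open>P\<close>, for
  positive \<open>x\<close> it sends \<open>Q x\<close> to an element between \<open>0\<close> and
  \<open>P x - P (P x) = 0\<close>. Only linearity of \<open>Q\<close> is assumed besides the
  bounds, so that \<open>Q\<close> may be a product whose idempotence is not yet known.\<close>

lemma order_projection_absorb:
  fixes P Q :: "'a::pre_riesz_space \<Rightarrow> 'a"
  assumes P: "order_projection P" and Q: "linear Q"
    and le: "\<And>x. 0 \<le> x \<Longrightarrow> 0 \<le> Q x \<and> Q x \<le> P x"
  shows "P (Q x) = Q x"
proof -
  note lin = order_projectionD(1)[OF P]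
  have "(\<lambda>x. P (Q x)) = Q"
  proof (rule linear_eq_onI_positive)
    show "linear (\<lambda>x. P (Q x))"
      using linear_compose[OF Q lin] by (simp add: o_def)
    fix x :: 'a assume "0 \<le> x"
    then have "0 \<le> Q x" "Q x - P (Q x) \<le> P x - P (P x)"
      using le order_projection_mono[OF order_projection_compl[OF P]] by blast+
    then show "P (Q x) = Q x"
      using order_projectionD(4)[OF P, of "Q x"] by (simp add: order_projectionD(2)[OF P])
  qed (rule Q)
  from fun_cong[OF this] show ?thesis .
qed

lemma order_projection_commute:
  fixes P Q :: "'a::pre_riesz_space \<Rightarrow> 'a"
  assumes P: "order_projection P" and Q: "order_projection Q"
  shows "P (Q x) = Q (P x)"
proof -
  have *: "P (Q (P x)) = Q (P x)" if P: "order_projection P" for P :: "'a \<Rightarrow> 'a" and x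
  proof (rule order_projection_absorb[OF P, where Q = "\<lambda>x. Q (P x)"])
    show "linear (\<lambda>x. Q (P x))"
      using linear_compose[OF order_projectionD(1)[OF P] order_projectionD(1)[OF Q]]
      by (simp add: o_def)
  qed (auto intro: order_projectionD[OF P] order_projectionD[OF Q])
  \<comment> \<open>For \<open>I - P\<close>, the identity \<open>*\<close> says that
    \<open>P Q (I - P) = 0\<close>.\<close>
  have "P (Q x) = P (Q (P x))"
    using *[OF order_projection_compl[OF P], of x]
    by (simp add: linear_diff order_projectionD[OF P] order_projectionD(1)[OF Q])
  then show ?thesis
    by (simp add: *[OF P])
qed

text \<open>Commutation yields idempotence; the bounds are those of the two factors chained.\<close>

lemma order_projection_comp:
  fixes P Q :: "'a::pre_riesz_space \<Rightarrow> 'a"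
  assumes P: "order_projection P" and Q: "order_projection Q"
  shows "order_projection (P \<circ> Q)"
  unfolding order_projection_def o_def
proof (intro conjI allI impI)
  show "linear (\<lambda>x. P (Q x))"
    using linear_compose[OF order_projectionD(1)[OF Q] order_projectionD(1)[OF P]]
    by (simp add: o_def)
  show "P (Q (P (Q x))) = P (Q x)" for x
    by (simp add: order_projection_commute[OF Q P] order_projectionD(2)[OF P]
        order_projectionD(2)[OF Q])
  show "0 \<le> P (Q x)" "P (Q x) \<le> x" if "0 \<le> x" for x
    using that order_projectionD(3,4)[OF P] order_projectionD(3,4)[OF Q]
    by (blast intro: order_trans)+
qed

text \<open>Reduces closure under joins to closure under complements and products.\<close>

lemma order_projection_join_de_morgan:
  assumes "linear P"
  shows "(\<lambda>x. P x + Q x - P (Q x)) = (\<lambda>x. x - ((\<lambda>x. x - P x) \<circ> (\<lambda>x. x - Q x)) x)"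
  by (auto simp: linear_diff[OF assms])

lemma order_projection_join:
  fixes P Q :: "'a::pre_riesz_space \<Rightarrow> 'a"
  assumes "order_projection P" "order_projection Q"
  shows "order_projection (\<lambda>x. P x + Q x - P (Q x))"
  unfolding order_projection_join_de_morgan[OF order_projectionD(1)[OF assms(1)]]
  by (intro order_projection_compl order_projection_comp assms)

lemma order_projection_zero: "order_projection (\<lambda>x. 0)"
  by (simp add: order_projection_def linear_zero)

lemma order_projection_id: "order_projection id"
  by (simp add: order_projection_def linear_id)

text \<open>A projection \<open>R\<close> below \<open>P\<close> is absorbed,
  \<open>R = P R\<close>, and monotonicity of \<open>P\<close> turns \<open>R <= Q\<close> into
  \<open>P R <= P Q\<close>.\<close>

lemma order_projection_le_comp:
  fixes P Q R :: "'a::pre_riesz_space \<Rightarrow> 'a"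
  assumes P: "order_projection P" and Q: "order_projection Q" and R: "order_projection R"
    and RP: "\<And>x. 0 \<le> x \<Longrightarrow> R x \<le> P x" and RQ: "\<And>x. 0 \<le> x \<Longrightarrow> R x \<le> Q x"
    and x: "0 \<le> x"
  shows "R x \<le> P (Q x)"
proof -
  have "R x = P (R x)"
    using order_projection_absorb[OF P order_projectionD(1)[OF R]] RP order_projectionD(3)[OF R]
    by simp
  also have "\<dots> \<le> P (Q x)"
    by (rule order_projection_mono[OF P RQ[OF x]])
  finally show ?thesis .
qed

text \<open>Dual to the bound for products: \<open>I - R\<close> lies below \<open>I - P\<close> and
  \<open>I - Q\<close>, hence below \<open>(I - P)(I - Q)\<close>.\<close>

lemma order_projection_join_le:
  fixes P Q R :: "'a::pre_riesz_space \<Rightarrow> 'a"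
  assumes P: "order_projection P" and Q: "order_projection Q" and R: "order_projection R"
    and PR: "\<And>x. 0 \<le> x \<Longrightarrow> P x \<le> R x" and QR: "\<And>x. 0 \<le> x \<Longrightarrow> Q x \<le> R x"
    and x: "0 \<le> x"
  shows "P x + Q x - P (Q x) \<le> R x"
  using order_projection_le_comp[OF order_projection_compl[OF P] order_projection_compl[OF Q]
      order_projection_compl[OF R] _ _ x] PR QR
  by (simp add: linear_diff[OF order_projectionD(1)[OF P]] algebra_simps)

section \<open>The lattice of band projections\<close>

lemma carrier_BandPr: "carrier BandPr = {P :: 'a::pre_riesz_space \<Rightarrow> 'a. order_projection P}"
  by (simp add: BandPr_def band_projection_iff_order_projection)

lemma eq_BandPr: "eq BandPr = (=)"
  by (simp add: BandPr_def)

lemma le_BandPr: "P \<sqsubseteq>\<^bsub>BandPr\<^esub> Q \<longleftrightarrow> (\<forall>x\<ge>0. P x \<le> Q x)"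
  by (auto simp: BandPr_def)

text \<open>For antisymmetry, the order compares operators on the cone only; linearity extends the
  equality to the whole space.\<close>

lemma partial_order_BandPr:
  "partial_order (BandPr :: ('a::pre_riesz_space \<Rightarrow> 'a) gorder)"
proof
  fix P Q :: "'a \<Rightarrow> 'a"
  assume "P \<sqsubseteq>\<^bsub>BandPr\<^esub> Q" "Q \<sqsubseteq>\<^bsub>BandPr\<^esub> P" "P \<in> carrier BandPr" "Q \<in> carrier BandPr"
  then show "P .=\<^bsub>BandPr\<^esub> Q"
    by (auto simp: carrier_BandPr le_BandPr eq_BandPr order_projectionD(1)
        intro!: linear_eq_onI_positive order.antisym[of "P _"])
qed (auto simp: eq_BandPr le_BandPr intro: order_trans)

text \<open>\<open>P Q <= Q\<close> comes from \<open>P <= I\<close>, and \<open>P Q <= P\<close>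
  from applying the monotone \<open>P\<close> to \<open>Q x <= x\<close>.\<close>

lemma greatest_Lower_BandPr:
  fixes P Q :: "'a::pre_riesz_space \<Rightarrow> 'a"
  assumes P: "order_projection P" and Q: "order_projection Q"
  shows "greatest BandPr (P \<circ> Q) (Lower BandPr {P, Q})"
proof -
  have "P (Q x) \<le> Q x" "P (Q x) \<le> P x" if "0 \<le> x" for x
    using order_projectionD(4)[OF P order_projectionD(3)[OF Q that]]
      order_projection_mono[OF P order_projectionD(4)[OF Q that]] by auto
  then show ?thesis
    using order_projection_comp[OF P Q] P Q order_projection_le_comp[OF P Q]
    by (auto simp: greatest_def Lower_def carrier_BandPr le_BandPr)
qed

lemma least_Upper_BandPr:
  fixes P Q :: "'a::pre_riesz_space \<Rightarrow> 'a"
  assumes P: "order_projection P" and Q: "order_projection Q"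
  shows "least BandPr (\<lambda>x. P x + Q x - P (Q x)) (Upper BandPr {P, Q})"
proof -
  have "P x \<le> P x + Q x - P (Q x)" "Q x \<le> P x + Q x - P (Q x)" if "0 \<le> x" for x
    using order_projectionD(4)[OF P order_projectionD(3)[OF Q that]]
      order_projection_mono[OF P order_projectionD(4)[OF Q that]]
    by (simp_all add: algebra_simps)
  then show ?thesis
    using order_projection_join[OF P Q] P Q order_projection_join_le[OF P Q]
    by (auto simp: least_def Upper_def carrier_BandPr le_BandPr)
qed

lemma least_BandPr: "least BandPr (\<lambda>x::'a::pre_riesz_space. 0) (carrier BandPr)"
  by (auto simp: least_def carrier_BandPr le_BandPr order_projection_zero order_projectionD)

lemma greatest_BandPr: "greatest BandPr (id :: 'a::pre_riesz_space \<Rightarrow> 'a) (carrier BandPr)"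
  by (auto simp: greatest_def carrier_BandPr le_BandPr order_projection_id order_projectionD)

lemma bounded_lattice_BandPr:
  "bounded_lattice (BandPr :: ('a::pre_riesz_space \<Rightarrow> 'a) gorder)"
proof -
  interpret partial_order "BandPr :: ('a \<Rightarrow> 'a) gorder"
    by (rule partial_order_BandPr)
  show ?thesis
    using least_Upper_BandPr greatest_Lower_BandPr least_BandPr greatest_BandPr
    by unfold_locales (unfold carrier_BandPr mem_Collect_eq, blast+)
qed

lemma bottom_BandPr: "\<bottom>\<^bsub>BandPr\<^esub> = (\<lambda>x::'a::pre_riesz_space. 0)"
proof -
  interpret bounded_lattice "BandPr :: ('a \<Rightarrow> 'a) gorder"
    by (rule bounded_lattice_BandPr)
  show ?thesis
    using least_unique[OF bottom_least least_BandPr] .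
qed

lemma top_BandPr: "\<top>\<^bsub>BandPr\<^esub> = (id :: 'a::pre_riesz_space \<Rightarrow> 'a)"
proof -
  interpret bounded_lattice "BandPr :: ('a \<Rightarrow> 'a) gorder"
    by (rule bounded_lattice_BandPr)
  show ?thesis
    using greatest_unique[OF top_greatest greatest_BandPr] .
qed

text \<open>The infimum is defined by choice among greatest lower bounds; antisymmetry leaves only
  one candidate.\<close>

lemma meet_BandPr:
  fixes P Q :: "'a::pre_riesz_space \<Rightarrow> 'a"
  assumes "order_projection P" "order_projection Q"
  shows "P \<sqinter>\<^bsub>BandPr\<^esub> Q = P \<circ> Q"
proof -
  interpret partial_order "BandPr :: ('a \<Rightarrow> 'a) gorder"
    by (rule partial_order_BandPr)
  show ?thesis
    unfolding meet_def inf_def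
    using greatest_Lower_BandPr[OF assms] by (blast intro: greatest_unique)
qed

lemma join_BandPr:
  fixes P Q :: "'a::pre_riesz_space \<Rightarrow> 'a"
  assumes "order_projection P" "order_projection Q"
  shows "P \<squnion>\<^bsub>BandPr\<^esub> Q = (\<lambda>x. P x + Q x - P (Q x))"
proof -
  interpret partial_order "BandPr :: ('a \<Rightarrow> 'a) gorder"
    by (rule partial_order_BandPr)
  show ?thesis
    unfolding join_def sup_def
    using least_Upper_BandPr[OF assms] by (blast intro: least_unique)
qed

section \<open>Complements and distributivity\<close>

text \<open>The conditions read \<open>P R = 0\<close> and \<open>P + R - P R = I\<close>; inserting
  the first into the second determines \<open>R\<close>. The equivalence thus gives existence and
  uniqueness at once.\<close>

lemma is_complement_BandPr_iff:
  fixes P R :: "'a::pre_riesz_space \<Rightarrow> 'a"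
  assumes P: "order_projection P"
  shows "is_complement BandPr P R \<longleftrightarrow> R = (\<lambda>x. x - P x)"
proof
  assume "is_complement BandPr P R"
  then have "order_projection R" "P \<sqinter>\<^bsub>BandPr\<^esub> R = \<bottom>\<^bsub>BandPr\<^esub>" "P \<squnion>\<^bsub>BandPr\<^esub> R = \<top>\<^bsub>BandPr\<^esub>"
    by (auto simp: is_complement_def carrier_BandPr)
  then have "P (R x) = 0" "P x + R x - P (R x) = x" for x
    by (simp_all add: meet_BandPr join_BandPr bottom_BandPr top_BandPr P fun_eq_iff)
  then show "R = (\<lambda>x. x - P x)"
    by (metis add_diff_cancel_left' diff_zero)
next
  assume R: "R = (\<lambda>x. x - P x)"
  show "is_complement BandPr P R"
    unfolding R using order_projection_compl[OF P]
    by (simp add: is_complement_def carrier_BandPr meet_BandPr join_BandPr bottom_BandPr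
        top_BandPr P fun_eq_iff linear_diff order_projectionD[OF P])
qed

lemma boolean_lattice_BandPr:
  "boolean_lattice (BandPr :: ('a::pre_riesz_space \<Rightarrow> 'a) gorder)"
proof -
  interpret bounded_lattice "BandPr :: ('a \<Rightarrow> 'a) gorder"
    by (rule bounded_lattice_BandPr)
  show ?thesis
  proof
    show "carrier (BandPr :: ('a \<Rightarrow> 'a) gorder) \<noteq> {}"
      using order_projection_id by (auto simp: carrier_BandPr)
    show "\<exists>Q. is_complement BandPr P Q" if "P \<in> carrier BandPr" for P :: "'a \<Rightarrow> 'a"
      using that by (simp add: is_complement_BandPr_iff carrier_BandPr)
    fix P Q R :: "'a \<Rightarrow> 'a"
    assume "P \<in> carrier BandPr" "Q \<in> carrier BandPr" "R \<in> carrier BandPr"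
    then have P: "order_projection P" and Q: "order_projection Q" and R: "order_projection R"
      by (auto simp: carrier_BandPr)
    note proj = P Q R order_projection_comp order_projection_join
    \<comment> \<open>Rules that expand both sides of the distributive laws and move
      \<open>P\<close> to the front of each product, where repeated factors \<open>P\<close> merge
      by idempotence.\<close>
    note ops = order_projectionD(2)[OF P] linear_add[OF order_projectionD(1)[OF P]]
      linear_diff[OF order_projectionD(1)[OF P]] linear_add[OF order_projectionD(1)[OF Q]]
      linear_diff[OF order_projectionD(1)[OF Q]]
      order_projection_commute[OF Q P] order_projection_commute[OF R P]
    show "P \<sqinter>\<^bsub>BandPr\<^esub> (Q \<squnion>\<^bsub>BandPr\<^esub> R) = (P \<sqinter>\<^bsub>BandPr\<^esub> Q) \<squnion>\<^bsub>BandPr\<^esub> (P \<sqinter>\<^bsub>BandPr\<^esub> R)"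
      by (simp add: meet_BandPr join_BandPr proj fun_eq_iff ops)
    show "P \<squnion>\<^bsub>BandPr\<^esub> (Q \<sqinter>\<^bsub>BandPr\<^esub> R) = (P \<squnion>\<^bsub>BandPr\<^esub> Q) \<sqinter>\<^bsub>BandPr\<^esub> (P \<squnion>\<^bsub>BandPr\<^esub> R)"
      by (simp add: meet_BandPr join_BandPr proj fun_eq_iff ops)
  qed
qed

theorem theorem3p8:
  shows "boolean_lattice (BandPr :: ('a::pre_riesz_space \<Rightarrow> 'a) gorder) \<and>
    \<bottom>\<^bsub>BandPr\<^esub> = (\<lambda>x::'a. 0) \<and>
    \<top>\<^bsub>BandPr\<^esub> = (id :: 'a \<Rightarrow> 'a) \<and>
    (\<forall>P Q :: 'a \<Rightarrow> 'a. band_projection P \<longrightarrow> band_projection Q \<longrightarrow>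
       P \<sqinter>\<^bsub>BandPr\<^esub> Q = P \<circ> Q \<and>
       P \<squnion>\<^bsub>BandPr\<^esub> Q = (\<lambda>x. P x + Q x - P (Q x))) \<and>
    (\<forall>P :: 'a \<Rightarrow> 'a. band_projection P \<longrightarrow>
       (\<forall>R. is_complement BandPr P R \<longleftrightarrow> R = (\<lambda>x. x - P x)))"
  by (simp add: boolean_lattice_BandPr bottom_BandPr top_BandPr meet_BandPr join_BandPr
      is_complement_BandPr_iff band_projection_iff_order_projection)

end
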